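(* Let $p\ge 1$, $r\ge 1$ and $k\ge 1$ be integers. Let $a$ and $b$ be the result of $k-1$ scalar operations performed using limited-precision stochastic rounding $\mathrm{SR}_{p,r}$, and let $\delta_1,\ldots,\delta_{k-1}$ be the relative rounding errors these operations have produced. Let $c=a\ \mathrm{op}\ b$ for $\mathrm{op}\in\{+,-,\times,\div\}$ (with $b\neq 0$ if $\mathrm{op}$ is $\div$), let $\beta_k$ be the relative error defined by $\mathrm{fl}_{p+r}(c)=c(1+\beta_k)$, corresponding to the truncation of $c$ to $p+r$ bits of precision, and let $\widehat{c}=\mathrm{SR}_{p,r}(c)=(a\ \mathrm{op}\ b)(1+\delta_k)$. Then the random variable $\delta_k$ satisfies $$\mathbb{E}(\delta_k\mid\delta_1,\ldots,\delta_{k-1})=\beta_k .$$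
   Context: Floating-point numbers: $\mathcal{F}$ is the precision-$p$ binary floating-point system, i.e. the set of $0$ and all real numbers $(-1)^s 2^e m$ with $s\in\{0,1\}$, $e$ an integer exponent, and $m\in[1,2)$ having at most $p$ significant bits. Standard model: no underflow or overflow occurs (the exponent range may be regarded as unlimited). For $x\in\mathbb{R}$, $\lceil x\rceil_p=\min\{y\in\mathcal{F}:y\ge x\}$ and $\lfloor x\rfloor_p=\max\{y\in\mathcal{F}:y\le x\}$. For $x\neq0$ written uniquely as $x=(-1)^s2^em$ with $m\in[1,2)$ real, $\mathrm{ulp}_p(x)=2^{e-p+1}$, and $\mathrm{fl}_{p+r}(x)$ is $x$ with the binary expansion of its significand $m$ truncated to the first $p+r$ significant bits; $\mathrm{fl}_{p+r}(0)=0$. Limited-precision stochastic rounding with $r$ random bits: $\mathrm{SR}_{p,r}(0)=0$, and for $x\ne0$, $\mathrm{SR}_{p,r}(x)$ is the random variable equal to $\lceil x\rceil_p$ with probability $q_r(x)$ and to $\lfloor x\rfloor_p$ with probability $1-q_r(x)$, where $q_r(x)=(\mathrm{fl}_{p+r}(x)-\lfloor x\rfloor_p)/\mathrm{ulp}_p(x)$. Sequence of operations: the operands of each operation are deterministic inputs or quantities determined by the results of previous operations, so $a$, $b$, and hence $c$ and $\beta_k$, are functions of $\delta_1,\ldots,\delta_{k-1}$; conditionally on the previous roundings, $\mathrm{SR}_{p,r}(c)$ has the two-point distribution above with $x=c$. If $c=0$, then $\delta_k=\beta_k=0$ by convention. *)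

theory Defs
  imports "HOL-Probability.Probability"
begin

text \<open>
  A nonzero real \<open>x\<close> is \<open>(-1)^s * 2 powi e * m\<close> with \<open>1 \<le> m < 2\<close> for
  exactly one sign and exactly one pair \<open>e = fexp x\<close>, \<open>m = fsig x\<close>; see
  \<open>fexp_fsig\<close> and \<open>fexp_fsig_unique\<close>. The values at \<open>0\<close> are irrelevant.
\<close>

definition fexp :: "real \<Rightarrow> int" where
  "fexp x = \<lfloor>log 2 \<bar>x\<bar>\<rfloor>"

definition fsig :: "real \<Rightarrow> real" where
  "fsig x = \<bar>x\<bar> / 2 powi fexp x"

lemma fexp_fsig:
  assumes "x \<noteq> 0"
  shows "x = sgn x * 2 powi fexp x * fsig x" "1 \<le> fsig x" "fsig x < 2"
proof -
  have *: "2 powi fexp x = 2 powr real_of_int (fexp x)"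
    by (simp add: powr_real_of_int')
  have "2 powr real_of_int (fexp x) \<le> \<bar>x\<bar>"
    using assms by (simp add: fexp_def flip: le_log_iff)
  moreover have "\<bar>x\<bar> < 2 powr (real_of_int (fexp x) + 1)"
    using assms by (simp add: fexp_def flip: log_less_iff)
  ultimately show "1 \<le> fsig x" "fsig x < 2"
    unfolding fsig_def * by (simp_all add: powr_add field_simps)
  show "x = sgn x * 2 powi fexp x * fsig x"
    unfolding fsig_def by (simp add: sgn_mult_abs)
qed

lemma fexp_fsig_unique:
  fixes m :: real
  assumes "x = (-1) ^ s * 2 powi e * m" "1 \<le> m" "m < 2"
  shows "fexp x = e" "fsig x = m"
proof -
  have abs: "\<bar>x\<bar> = 2 powi e * m"
    using assms by (simp add: abs_mult power_abs)
  have *: "(2::real) powi e = 2 powr real_of_int e"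
    by (simp add: powr_real_of_int')
  have "log 2 \<bar>x\<bar> = real_of_int e + log 2 m"
    using assms unfolding abs * by (subst log_mult) auto
  moreover have "0 \<le> log 2 m" "log 2 m < 1"
    using assms by auto
  ultimately show e: "fexp x = e"
    unfolding fexp_def by linarith
  show "fsig x = m"
    unfolding fsig_def e abs by simp
qed

text \<open>
  A significand \<open>m \<in> [1,2)\<close> has at most \<open>p\<close> significant bits iff it is an
  integer multiple of \<open>2 ^ -(p - 1)\<close>. The natural subtractions \<open>p - 1\<close> and
  \<open>n - 1\<close> below are meant for \<open>p, n \<ge> 1\<close>.
\<close>

definition fp_set :: "nat \<Rightarrow> real set" where
  "fp_set p = {0} \<union>
     {(-1) ^ s * 2 powi e * m | (s::nat) (e::int) (m::real).
        s \<in> {0, 1} \<and> 1 \<le> m \<and> m < 2 \<and> m * 2 ^ (p - 1) \<in> \<int>}"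

definition fp_ceil :: "nat \<Rightarrow> real \<Rightarrow> real" where
  "fp_ceil p x = (LEAST y. y \<in> fp_set p \<and> x \<le> y)"

definition fp_floor :: "nat \<Rightarrow> real \<Rightarrow> real" where
  "fp_floor p x = (GREATEST y. y \<in> fp_set p \<and> y \<le> x)"

definition fp_ulp :: "nat \<Rightarrow> real \<Rightarrow> real" where
  "fp_ulp p x = 2 powi (fexp x - int p + 1)"

text \<open>Truncation of the significand, hence towards zero for either sign of \<open>x\<close>.\<close>

definition fp_trunc :: "nat \<Rightarrow> real \<Rightarrow> real" where
  "fp_trunc n x =
     (if x = 0 then 0
      else sgn x * 2 powi fexp x * (real_of_int \<lfloor>fsig x * 2 ^ (n - 1)\<rfloor> / 2 ^ (n - 1)))"

definition sr_prob :: "nat \<Rightarrow> nat \<Rightarrow> real \<Rightarrow> real" where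
  "sr_prob p r x = (fp_trunc (p + r) x - fp_floor p x) / fp_ulp p x"

text \<open>
  \<open>bernoulli_pmf\<close> clips its parameter to \<open>[0,1]\<close>, which has no effect here:
  \<open>fp_floor p x \<le> fp_trunc (p + r) x \<le> fp_floor p x + fp_ulp p x\<close> for \<open>x \<noteq> 0\<close>, \<open>p \<ge> 1\<close>.
\<close>

definition SR :: "nat \<Rightarrow> nat \<Rightarrow> real \<Rightarrow> real pmf" where
  "SR p r x =
     (if x = 0 then return_pmf 0
      else map_pmf (\<lambda>up. if up then fp_ceil p x else fp_floor p x)
             (bernoulli_pmf (sr_prob p r x)))"

text \<open>
  The relative error \<open>d\<close> defined by \<open>y = c * (1 + d)\<close>, with \<open>d = 0\<close> by
  convention if \<open>c = 0\<close>.
\<close>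

definition rel_err :: "real \<Rightarrow> real \<Rightarrow> real" where
  "rel_err c y = (if c = 0 then 0 else (y - c) / c)"

lemma rel_err_iff: "c \<noteq> 0 \<Longrightarrow> y = c * (1 + d) \<longleftrightarrow> d = rel_err c y"
  by (auto simp: rel_err_def field_simps)

datatype arith_op = Add | Sub | Mul | Div

primrec apply_op :: "arith_op \<Rightarrow> real \<Rightarrow> real \<Rightarrow> real" where
  "apply_op Add x y = x + y"
| "apply_op Sub x y = x - y"
| "apply_op Mul x y = x * y"
| "apply_op Div x y = x / y"

text \<open>The history \<open>(X 1, \<dots>, X (i - 1))\<close> of a process, and the sigma-algebra it generates.\<close>

definition past :: "(nat \<Rightarrow> 'a \<Rightarrow> real) \<Rightarrow> nat \<Rightarrow> 'a \<Rightarrow> nat \<Rightarrow> real" where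
  "past X i \<omega> = (\<lambda>j\<in>{1..<i}. X j \<omega>)"

abbreviation past_space :: "nat \<Rightarrow> (nat \<Rightarrow> real) measure" where
  "past_space i \<equiv> (\<Pi>\<^sub>M j\<in>{1..<i}. borel)"

definition past_sigma :: "'a measure \<Rightarrow> (nat \<Rightarrow> 'a \<Rightarrow> real) \<Rightarrow> nat \<Rightarrow> 'a measure" where
  "past_sigma M X i = vimage_algebra (space M) (past X i) (past_space i)"

text \<open>Conditionally on the sub-sigma-algebra \<open>F\<close>, the random variable \<open>X\<close> has law \<open>K\<close>.\<close>

definition cond_law :: "'a measure \<Rightarrow> 'a measure \<Rightarrow> ('a \<Rightarrow> real) \<Rightarrow> ('a \<Rightarrow> real pmf) \<Rightarrow> bool" where
  "cond_law M F X K \<longleftrightarrow>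
     (\<forall>B \<in> sets borel. AE \<omega> in M.
        real_cond_exp M F (\<lambda>\<omega>. indicator B (X \<omega>)) \<omega> = measure_pmf.prob (K \<omega>) B)"

end

theory Submission
  imports Defs
begin

text \<open>
  For \<open>x \<noteq> 0\<close> the floats adjacent to \<open>x\<close> are the multiples of \<open>fp_ulp p x\<close> just below and just
  above \<open>x\<close> (\<open>fp_floor_eq\<close>, \<open>fp_ceil_eq\<close>). Hence they coincide or differ by one ulp, the
  truncation of \<open>x\<close> to \<open>p + r\<close> bits lies between them, and choosing the upper one with
  probability \<open>sr_prob p r x\<close> yields the truncation as mean value. The mean relative error of
  \<open>SR p r x\<close> is therefore the relative error of the truncation (\<open>expectation_rel_err_SR\<close>).
  Moreover the relative error is at most \<open>1\<close> in absolute value, since one ulp does not exceed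
  \<open>|x|\<close>; this gives integrability.

  To pass to conditional expectations, \<open>c k\<close> must be known given the earlier errors. It is a
  function of the earlier computed values, and each of these equals
  \<open>c j * (1 + \<delta> j)\<close> almost surely, also where \<open>c j = 0\<close>, because \<open>SR p r 0\<close> is the point mass
  at \<open>0\<close>. By induction \<open>c k\<close> agrees almost surely with a random variable \<open>c'\<close> that is
  measurable with respect to the earlier errors. The floats form a countable set, so the space
  splits into countably many events of the past on which both neighbours of \<open>c'\<close> are constant.
  On each of them \<open>\<delta> k\<close> is almost surely a sum of at most two products of a past-measurable factor with the
  indicator of an event \<open>{chat k = v}\<close>, whose conditional probability is given by the
  conditional law (\<open>real_cond_exp_two_point_kernel\<close>). So the conditional expectation of \<open>\<delta> k\<close> is
  the mean of the relative error under \<open>SR p r (c k)\<close>.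
\<close>

section \<open>Floating-point numbers near a real number\<close>

lemma countable_fp_set: "countable (fp_set p)"
proof -
  have "fp_set p \<subseteq> {0} \<union> (\<lambda>(s, e, n). (-1) ^ s * 2 powi e * (real_of_int n / 2 ^ (p - 1))) `
          (UNIV :: (nat \<times> int \<times> int) set)" (is "_ \<subseteq> {0} \<union> ?g ` _")
  proof
    fix y assume "y \<in> fp_set p"
    then consider "y = 0"
      | s :: nat and e :: int and m where "y = (-1) ^ s * 2 powi e * m" "m * 2 ^ (p - 1) \<in> \<int>"
      unfolding fp_set_def by blast
    then show "y \<in> {0} \<union> ?g ` UNIV"
    proof cases
      case (2 s e m)
      from 2(2) obtain n where "m * 2 ^ (p - 1) = real_of_int n" by (auto elim: Ints_cases)
      then have "y = ?g (s, e, n)" using 2(1) by (simp add: field_simps)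
      then show ?thesis by blast
    qed simp
  qed
  then show ?thesis by (rule countable_subset) auto
qed

lemma fp_set_uminus: "y \<in> fp_set p \<Longrightarrow> - y \<in> fp_set p"
proof -
  assume "y \<in> fp_set p"
  then consider "y = 0"
    | s :: nat and e :: int and m where "s \<in> {0, 1}" "y = (-1) ^ s * 2 powi e * m"
        "1 \<le> m" "m < 2" "m * 2 ^ (p - 1) \<in> \<int>"
    unfolding fp_set_def by blast
  then show ?thesis
  proof cases
    case (2 s e m)
    then have "- y = (-1) ^ (1 - s) * 2 powi e * m" "1 - s \<in> {0, 1}" by auto
    with 2 show ?thesis unfolding fp_set_def by blast
  qed (simp add: fp_set_def)
qed

lemma fp_ulp_pos: "fp_ulp p x > 0"
  by (simp add: fp_ulp_def)

lemma two_powi_fexp_eq_ulp: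
  assumes "p \<ge> 1"
  shows "2 powi fexp x = fp_ulp p x * 2 ^ (p - 1)"
proof -
  have "(2::real) ^ (p - 1) = 2 powi (int p - 1)"
    using assms by (simp add: of_nat_diff flip: power_int_of_nat)
  then show ?thesis
    by (simp add: fp_ulp_def flip: power_int_add)
qed

lemma abs_div_ulp:
  assumes "p \<ge> 1"
  shows "\<bar>x\<bar> / fp_ulp p x = fsig x * 2 ^ (p - 1)"
  using fp_ulp_pos[of p x] two_powi_fexp_eq_ulp[OF assms, of x]
  by (simp add: fsig_def field_simps)

lemma ulp_le_abs:
  assumes "p \<ge> 1" "x \<noteq> 0"
  shows "fp_ulp p x * 2 ^ (p - 1) \<le> \<bar>x\<bar>" "\<bar>x\<bar> < fp_ulp p x * 2 ^ p"
proof -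
  have eq: "\<bar>x\<bar> = fp_ulp p x * (fsig x * 2 ^ (p - 1))"
    using abs_div_ulp[OF assms(1), of x] fp_ulp_pos[of p x] by (simp add: field_simps)
  have "2 * 2 ^ (p - 1) = (2::real) ^ p"
    using assms(1) by (cases p) auto
  moreover have "fsig x * 2 ^ (p - 1) < 2 * 2 ^ (p - 1)"
    using fexp_fsig(3)[OF assms(2)] by simp
  ultimately show "\<bar>x\<bar> < fp_ulp p x * 2 ^ p"
    unfolding eq using fp_ulp_pos[of p x] by (intro mult_strict_left_mono) linarith+
  show "fp_ulp p x * 2 ^ (p - 1) \<le> \<bar>x\<bar>"
    unfolding eq using fexp_fsig(2)[OF assms(2)] fp_ulp_pos[of p x]
    by (intro mult_left_mono) auto
qed

text \<open>
  The next two lemmas compare floats with the integer multiples of \<open>fp_ulp p x\<close>. Multiples of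
  absolute value at most \<open>2 powi (fexp x + 1)\<close>, the boundary included, are floats; conversely,
  floats of absolute value at least \<open>2 powi fexp x\<close> are such multiples.
\<close>

lemma ulp_multiple_in_fp_set:
  assumes "p \<ge> 1" and n: "\<bar>n\<bar> \<le> 2 ^ p"
  shows "fp_ulp p x * real_of_int n \<in> fp_set p"
proof (cases "n = 0")
  case True
  then show ?thesis by (simp add: fp_set_def)
next
  case False
  define j where "j = fexp (real_of_int n)"
  define m where "m = fsig (real_of_int n)"
  have n0: "real_of_int n \<noteq> 0" using False by simp
  note [simp] = fexp_fsig(2,3)[OF n0, folded m_def]
  have absn: "\<bar>real_of_int n\<bar> = 2 powi j * m"
    by (simp add: m_def j_def fsig_def)
  have eq: "fp_ulp p x * real_of_int n
      = (-1) ^ (if n < 0 then 1 else 0) * 2 powi (fexp x - int p + 1 + j) * m"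
    using absn by (auto simp: fp_ulp_def power_int_add split: if_splits)
  have "m * 2 ^ (p - 1) \<in> \<int>"
  proof (cases "j \<le> int (p - 1)")
    case True
    have "m * 2 ^ (p - 1) = \<bar>real_of_int n\<bar> * (2 ^ (p - 1) / 2 powi j)"
      unfolding absn by simp
    also have "2 ^ (p - 1) / 2 powi j = (2::real) powi (int (p - 1) - j)"
      by (simp add: power_int_diff)
    also have "\<dots> = 2 ^ nat (int (p - 1) - j)"
      using True by (simp add: power_int_def)
    finally show ?thesis by simp
  next
    case False
    \<comment> \<open>Then \<open>|n|\<close> is \<open>2 ^ p\<close>, with significand \<open>1\<close>.\<close>
    have "real_of_int \<bar>n\<bar> \<le> real_of_int (2 ^ p)" using n by (simp only: of_int_le_iff)
    then have "2 powi j * m \<le> 2 ^ p" using absn by simp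
    moreover have "(2::real) ^ p \<le> 2 powi j"
      using False \<open>p \<ge> 1\<close> by (subst power_int_of_nat[symmetric], intro power_int_increasing) auto
    ultimately have "2 powi j * m \<le> 2 powi j * 1" by linarith
    then have "m \<le> 1" by (subst (asm) mult_le_cancel_left_pos) auto
    then have "m = 1" using fexp_fsig(2)[OF n0, folded m_def] by linarith
    then show ?thesis by simp
  qed
  then show ?thesis
    unfolding fp_set_def eq
    by (intro UnI2 CollectI exI conjI) (rule refl, auto)
qed

lemma fp_set_large_imp_ulp_multiple:
  assumes "p \<ge> 1" "y \<in> fp_set p" "fp_ulp p x * 2 ^ (p - 1) \<le> \<bar>y\<bar>"
  obtains n where "y = fp_ulp p x * real_of_int n"
proof -
  have "0 < fp_ulp p x * 2 ^ (p - 1)" using fp_ulp_pos[of p x] by simp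
  then have "y \<noteq> 0" using assms(3) by linarith
  with assms(2) obtain s :: nat and e m where y: "y = (-1) ^ s * 2 powi e * m"
    and m: "1 \<le> m" "m < 2" and mi: "m * 2 ^ (p - 1) \<in> \<int>"
    unfolding fp_set_def by blast
  have "2 powi fexp x < (2::real) powi (e + 1)"
  proof -
    have "2 powi fexp x \<le> \<bar>y\<bar>" using assms(3) two_powi_fexp_eq_ulp[OF assms(1), of x] by simp
    also have "\<dots> = 2 powi e * m" using m by (simp add: y abs_mult power_abs)
    also have "\<dots> < 2 powi e * 2" using m by simp
    finally show ?thesis by (simp add: power_int_add)
  qed
  then have e: "fexp x \<le> e"
    using power_int_increasing[of "e + 1" "fexp x" "2::real"] by linarith
  from mi obtain k where k: "m * 2 ^ (p - 1) = real_of_int k" by (auto elim: Ints_cases)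
  have "(2::real) powi e = 2 powi fexp x * 2 ^ nat (e - fexp x)"
    using e by (simp flip: power_int_of_nat power_int_add)
  then have "y = fp_ulp p x * real_of_int ((-1) ^ s * 2 ^ nat (e - fexp x) * k)"
    unfolding y two_powi_fexp_eq_ulp[OF assms(1), of x] by (simp flip: k)
  then show thesis by (rule that)
qed

lemma fp_floor_eqI:
  assumes "y \<in> fp_set p" "y \<le> x" "\<And>z. z \<in> fp_set p \<Longrightarrow> z \<le> x \<Longrightarrow> z \<le> y"
  shows "fp_floor p x = y"
  unfolding fp_floor_def using assms by (intro Greatest_equality) auto

lemma fp_ceil_eqI:
  assumes "y \<in> fp_set p" "x \<le> y" "\<And>z. z \<in> fp_set p \<Longrightarrow> x \<le> z \<Longrightarrow> y \<le> z"
  shows "fp_ceil p x = y"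
  unfolding fp_ceil_def using assms by (intro Least_equality) auto

lemma abs_floor_div_ulp_le:
  assumes "p \<ge> 1" "x \<noteq> 0"
  shows "\<bar>\<lfloor>x / fp_ulp p x\<rfloor>\<bar> \<le> 2 ^ p"
proof -
  have "\<bar>x / fp_ulp p x\<bar> < 2 ^ p"
    using ulp_le_abs(2)[OF assms] fp_ulp_pos[of p x]
    by (simp add: abs_divide pos_divide_less_eq mult.commute)
  then have "x / fp_ulp p x < of_int (2 ^ p)" "of_int (- (2 ^ p)) \<le> x / fp_ulp p x"
    unfolding of_int_minus of_int_power of_int_numeral by linarith+
  then have "\<lfloor>x / fp_ulp p x\<rfloor> < 2 ^ p" "- (2 ^ p) \<le> \<lfloor>x / fp_ulp p x\<rfloor>"
    unfolding floor_less_iff le_floor_iff by simp_all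
  then show ?thesis by linarith
qed

lemma fp_set_le_ulp_floor:
  assumes p: "p \<ge> 1" and x: "x \<noteq> 0" and z: "z \<in> fp_set p" "z \<le> x"
  shows "z \<le> fp_ulp p x * \<lfloor>x / fp_ulp p x\<rfloor>"
proof -
  let ?u = "fp_ulp p x"
  note u = fp_ulp_pos[of p x] and xb = ulp_le_abs(1)[OF p x]
  show ?thesis
  proof (cases "?u * 2 ^ (p - 1) \<le> \<bar>z\<bar>")
    case True
    then obtain n where n: "z = ?u * real_of_int n"
      using fp_set_large_imp_ulp_multiple[OF p z(1)] by blast
    have "n \<le> \<lfloor>x / ?u\<rfloor>"
      unfolding le_floor_iff using z(2) u by (simp add: n field_simps)
    then show ?thesis unfolding n using u by simp
  next
    case False
    \<comment> \<open>Here \<open>x > 0\<close>, and the binade boundary below \<open>x\<close> separates \<open>z\<close> from \<open>x\<close>.\<close>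
    then have zx: "z < ?u * 2 ^ (p - 1)" "?u * 2 ^ (p - 1) \<le> x"
      using z(2) xb by linarith+
    have "2 ^ (p - 1) \<le> \<lfloor>x / ?u\<rfloor>"
      unfolding le_floor_iff using zx(2) u by (simp add: field_simps)
    then have "real_of_int (2 ^ (p - 1)) \<le> real_of_int \<lfloor>x / ?u\<rfloor>"
      by (simp only: of_int_le_iff)
    then have "?u * 2 ^ (p - 1) \<le> ?u * \<lfloor>x / ?u\<rfloor>"
      using u by simp
    then show ?thesis using zx(1) by linarith
  qed
qed

lemma ulp_mult_floor_le: "fp_ulp p x * \<lfloor>y / fp_ulp p x\<rfloor> \<le> y"
  using of_int_floor_le[of "y / fp_ulp p x"] fp_ulp_pos[of p x]
  by (simp only: le_divide_eq) (simp add: mult.commute)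

lemma fp_floor_eq:
  assumes "p \<ge> 1" "x \<noteq> 0"
  shows "fp_floor p x = fp_ulp p x * \<lfloor>x / fp_ulp p x\<rfloor>"
proof (rule fp_floor_eqI)
  show "fp_ulp p x * \<lfloor>x / fp_ulp p x\<rfloor> \<in> fp_set p"
    by (rule ulp_multiple_in_fp_set[OF assms(1) abs_floor_div_ulp_le[OF assms]])
qed (rule ulp_mult_floor_le fp_set_le_ulp_floor[OF assms])+

lemma fp_ulp_uminus: "fp_ulp p (- x) = fp_ulp p x"
  by (simp add: fp_ulp_def fexp_def)

lemma fp_floor_0: "fp_floor p 0 = 0"
  by (rule fp_floor_eqI) (auto simp: fp_set_def)

text \<open>\<open>fp_floor\<close> is defined by a choice of a greatest element; here its existence is established.\<close>

lemma fp_floor_props: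
  assumes "p \<ge> 1"
  shows "fp_floor p x \<in> fp_set p" "fp_floor p x \<le> x"
    "z \<in> fp_set p \<Longrightarrow> z \<le> x \<Longrightarrow> z \<le> fp_floor p x"
proof -
  have "\<exists>y. y \<in> fp_set p \<and> y \<le> x \<and> (\<forall>z. z \<in> fp_set p \<longrightarrow> z \<le> x \<longrightarrow> z \<le> y)"
  proof (cases "x = 0")
    case True
    then show ?thesis by (intro exI[of _ 0]) (auto simp: fp_set_def)
  next
    case False
    show ?thesis
      using ulp_mult_floor_le[of p x x] ulp_multiple_in_fp_set[OF assms(1) abs_floor_div_ulp_le[OF assms False]]
        fp_set_le_ulp_floor[OF assms False] by blast
  qed
  then obtain y where y: "y \<in> fp_set p" "y \<le> x" "\<And>z. z \<in> fp_set p \<Longrightarrow> z \<le> x \<Longrightarrow> z \<le> y"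
    by blast
  with fp_floor_eqI[OF y] show "fp_floor p x \<in> fp_set p" "fp_floor p x \<le> x"
    "z \<in> fp_set p \<Longrightarrow> z \<le> x \<Longrightarrow> z \<le> fp_floor p x" by auto
qed

lemma fp_ceil_eq_uminus_floor:
  assumes "p \<ge> 1"
  shows "fp_ceil p x = - fp_floor p (- x)"
proof (rule fp_ceil_eqI)
  show "- fp_floor p (- x) \<in> fp_set p" "x \<le> - fp_floor p (- x)"
    using fp_floor_props(1,2)[OF assms, of "- x"] fp_set_uminus by auto
  show "- fp_floor p (- x) \<le> z" if "z \<in> fp_set p" "x \<le> z" for z
    using fp_floor_props(3)[OF assms, of "- z" "- x"] fp_set_uminus that by auto
qed

lemma mono_fp_floor: "p \<ge> 1 \<Longrightarrow> mono (fp_floor p)"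
  by (meson fp_floor_props monoI order_trans)

lemma borel_measurable_fp_floor: "p \<ge> 1 \<Longrightarrow> fp_floor p \<in> borel_measurable borel"
  by (intro borel_measurable_mono mono_fp_floor)

lemma borel_measurable_fp_ceil:
  assumes "p \<ge> 1"
  shows "fp_ceil p \<in> borel_measurable borel"
proof -
  note [measurable] = borel_measurable_fp_floor[OF assms]
  show ?thesis
    unfolding fp_ceil_eq_uminus_floor[OF assms, abs_def] by measurable
qed

lemma fp_ceil_in_fp_set: "p \<ge> 1 \<Longrightarrow> fp_ceil p x \<in> fp_set p"
  by (simp add: fp_ceil_eq_uminus_floor fp_floor_props(1) fp_set_uminus)

lemma fp_ceil_eq:
  assumes "p \<ge> 1" "x \<noteq> 0"
  shows "fp_ceil p x = fp_ulp p x * \<lceil>x / fp_ulp p x\<rceil>"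
  using fp_floor_eq[OF assms(1), of "- x"] assms
  by (simp add: fp_ceil_eq_uminus_floor fp_ulp_uminus ceiling_def)

section \<open>The mean of one rounding\<close>

lemma fp_trunc_eq:
  assumes "n \<ge> 1" "x \<noteq> 0"
  shows "fp_trunc n x = sgn x * (fp_ulp n x * \<lfloor>\<bar>x\<bar> / fp_ulp n x\<rfloor>)"
  using assms two_powi_fexp_eq_ulp[OF assms(1), of x] abs_div_ulp[OF assms(1), of x]
  by (simp add: fp_trunc_def)

lemma fp_trunc_bounds:
  assumes p: "p \<ge> 1" and x: "x \<noteq> 0"
  shows "fp_floor p x \<le> fp_trunc (p + r) x" "fp_trunc (p + r) x \<le> fp_ceil p x"
proof -
  let ?u = "fp_ulp p x" and ?v = "fp_ulp (p + r) x"
  note u = fp_ulp_pos[of p x] and v = fp_ulp_pos[of "p + r" x]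
  have uv: "?u = ?v * 2 ^ r"
    by (simp add: fp_ulp_def algebra_simps flip: power_int_of_nat power_int_add)
  define t where "t = ?v * \<lfloor>\<bar>x\<bar> / ?v\<rfloor>"
  have t_le: "t \<le> \<bar>x\<bar>"
    unfolding t_def by (rule ulp_mult_floor_le)
  \<comment> \<open>Multiples of \<open>?u\<close> are multiples of \<open>?v\<close>, so rounding down to the coarser grid loses more.\<close>
  have t_ge: "?u * \<lfloor>\<bar>x\<bar> / ?u\<rfloor> \<le> t"
  proof -
    have "2 ^ r * real_of_int \<lfloor>\<bar>x\<bar> / ?u\<rfloor> * ?v \<le> \<bar>x\<bar>"
      using ulp_mult_floor_le[of p x "\<bar>x\<bar>"] by (simp only: uv mult_ac)
    then have "2 ^ r * real_of_int \<lfloor>\<bar>x\<bar> / ?u\<rfloor> \<le> \<bar>x\<bar> / ?v"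
      using v by (simp only: le_divide_eq if_True)
    then have "2 ^ r * \<lfloor>\<bar>x\<bar> / ?u\<rfloor> \<le> \<lfloor>\<bar>x\<bar> / ?v\<rfloor>"
      by (simp add: le_floor_iff)
    then have "real_of_int (2 ^ r * \<lfloor>\<bar>x\<bar> / ?u\<rfloor>) \<le> real_of_int \<lfloor>\<bar>x\<bar> / ?v\<rfloor>"
      by (simp only: of_int_le_iff)
    then have "?v * (2 ^ r * real_of_int \<lfloor>\<bar>x\<bar> / ?u\<rfloor>) \<le> t"
      unfolding t_def using v by (intro mult_left_mono) auto
    then show ?thesis by (simp add: uv mult.assoc)
  qed
  have fl: "fp_floor p y \<le> y" "y \<le> fp_ceil p y" for y
    using fp_floor_props(2)[OF p, of y] fp_floor_props(2)[OF p, of "- y"]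
    by (auto simp: fp_ceil_eq_uminus_floor[OF p])
  have tr: "fp_trunc (p + r) x = sgn x * t"
    unfolding t_def using p x by (intro fp_trunc_eq) auto
  have "fp_floor p x \<le> sgn x * t \<and> sgn x * t \<le> fp_ceil p x"
  proof (cases "x > 0")
    case True
    then show ?thesis
      using t_ge t_le fl(2)[of x] by (simp add: fp_floor_eq[OF p x])
  next
    case False
    then have "x < 0" using x by simp
    moreover have "?u * \<lfloor>- x / ?u\<rfloor> = - fp_ceil p x"
      using fp_ceil_eq[OF p x] by (simp add: ceiling_def)
    ultimately show ?thesis
      using t_ge t_le fl(1)[of x] by simp
  qed
  then show "fp_floor p x \<le> fp_trunc (p + r) x" "fp_trunc (p + r) x \<le> fp_ceil p x"
    by (auto simp: tr)
qed

lemma fp_ceil_minus_floor: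
  assumes "p \<ge> 1" "x \<noteq> 0"
  shows "fp_ceil p x = fp_floor p x \<or> fp_ceil p x = fp_floor p x + fp_ulp p x"
proof -
  let ?t = "x / fp_ulp p x"
  have "\<lceil>?t\<rceil> = \<lfloor>?t\<rfloor> \<or> \<lceil>?t\<rceil> = \<lfloor>?t\<rfloor> + 1" by linarith
  then show ?thesis
    unfolding fp_floor_eq[OF assms] fp_ceil_eq[OF assms] by (auto simp: algebra_simps)
qed

lemma sr_prob_in_unit_interval:
  assumes "p \<ge> 1" "x \<noteq> 0"
  shows "0 \<le> sr_prob p r x" "sr_prob p r x \<le> 1"
  using fp_trunc_bounds[OF assms, of r] fp_ceil_minus_floor[OF assms] fp_ulp_pos[of p x]
  by (auto simp: sr_prob_def)

text \<open>
  For a float \<open>x\<close> the gap vanishes and so does \<open>sr_prob p r x\<close>; otherwise the gap is one ulp.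
\<close>

lemma sr_prob_mult_gap:
  assumes "p \<ge> 1" "x \<noteq> 0"
  shows "sr_prob p r x * (fp_ceil p x - fp_floor p x) = fp_trunc (p + r) x - fp_floor p x"
  using fp_trunc_bounds[OF assms, of r] fp_ceil_minus_floor[OF assms] fp_ulp_pos[of p x]
  by (auto simp: sr_prob_def)

lemma set_pmf_SR:
  assumes "p \<ge> 1"
  shows "set_pmf (SR p r x) \<subseteq> {fp_floor p x, fp_ceil p x}"
  by (auto simp: SR_def fp_floor_0)

lemma abs_rel_err_le_1:
  assumes "p \<ge> 1" "y \<in> {fp_floor p x, fp_ceil p x}"
  shows "\<bar>rel_err x y\<bar> \<le> 1"
proof (cases "x = 0")
  case False
  have "fp_floor p x \<le> x" "x \<le> fp_ceil p x"
    using fp_floor_props(2)[OF assms(1), of x] fp_floor_props(2)[OF assms(1), of "- x"]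
    by (auto simp: fp_ceil_eq_uminus_floor[OF assms(1)])
  then have "\<bar>y - x\<bar> \<le> fp_ulp p x"
    using fp_ceil_minus_floor[OF assms(1) False] assms(2) fp_ulp_pos[of p x] by auto
  also have "\<dots> = fp_ulp p x * 1" by simp
  also have "\<dots> \<le> fp_ulp p x * 2 ^ (p - 1)"
    using fp_ulp_pos[of p x] by (intro mult_left_mono) auto
  also have "\<dots> \<le> \<bar>x\<bar>" by (rule ulp_le_abs(1)[OF assms(1) False])
  finally show ?thesis using False by (simp add: rel_err_def)
qed (simp add: rel_err_def)

text \<open>
  For \<open>x \<noteq> 0\<close>, rounding up with probability \<open>sr_prob p r x\<close> has the truncation of \<open>x\<close> as its
  mean, and the relative error is affine in the rounded value.
\<close>

lemma expectation_rel_err_SR: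
  assumes "p \<ge> 1"
  shows "measure_pmf.expectation (SR p r x) (rel_err x) = rel_err x (fp_trunc (p + r) x)"
proof (cases "x = 0")
  case False
  let ?q = "sr_prob p r x"
  have "measure_pmf.expectation (SR p r x) (rel_err x)
      = ?q * rel_err x (fp_ceil p x) + (1 - ?q) * rel_err x (fp_floor p x)"
    using False sr_prob_in_unit_interval[OF assms False, of r] by (simp add: SR_def)
  also have "\<dots> = (fp_floor p x + ?q * (fp_ceil p x - fp_floor p x) - x) / x"
    using False by (simp add: rel_err_def field_simps)
  also have "\<dots> = rel_err x (fp_trunc (p + r) x)"
    using False by (simp add: sr_prob_mult_gap[OF assms False] rel_err_def)
  finally show ?thesis .
qed (simp add: rel_err_def[abs_def])

section \<open>Conditional expectations from conditional laws\<close>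

lemma finite_measure_subalgebraI:
  assumes "prob_space M" "subalgebra M F"
  shows "finite_measure_subalgebra M F"
  using assms by (simp add: finite_measure_subalgebra_def finite_measure_subalgebra_axioms_def
      prob_space.finite_measure)

text \<open>
  On an event \<open>A\<close> of \<open>F\<close> on which the conditional law is carried by \<open>B\<close>, almost surely \<open>X \<in> B\<close>:
  given \<open>F\<close>, the event \<open>X \<in> B\<close> has probability \<open>1\<close> there, so \<open>A \<inter> {X \<notin> B}\<close> is a null set.
\<close>

lemma cond_law_AE_in:
  assumes M: "prob_space M" "subalgebra M F" and law: "cond_law M F X K"
    and [measurable]: "X \<in> borel_measurable M" "B \<in> sets borel" and A: "A \<in> sets F"
    and supp: "AE \<omega> in M. \<omega> \<in> A \<longrightarrow> set_pmf (K \<omega>) \<subseteq> B"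
  shows "AE \<omega> in M. \<omega> \<in> A \<longrightarrow> X \<omega> \<in> B"
proof -
  interpret finite_measure_subalgebra M F
    by (rule finite_measure_subalgebraI[OF M])
  interpret prob_space M by fact
  have [measurable]: "A \<in> sets M" using A subalg by (auto simp: subalgebra_def)
  let ?I = "\<lambda>\<omega>. indicator B (X \<omega>) :: real"
  have int: "integrable M ?I"
    by (rule integrable_const_bound[of _ 1]) (auto simp: indicator_def)
  have intA: "integrable M (\<lambda>\<omega>. indicator A \<omega> * ?I \<omega>)" "integrable M (indicator A :: _ \<Rightarrow> real)"
    by (rule integrable_const_bound[of _ 1], auto simp: indicator_def)+
  have "(\<integral>\<omega>. indicator A \<omega> * ?I \<omega> \<partial>M) = (\<integral>\<omega>. indicator A \<omega> * real_cond_exp M F ?I \<omega> \<partial>M)"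
    using real_cond_exp_intA[OF int A] by (simp add: set_lebesgue_integral_def)
  also have "\<dots> = (\<integral>\<omega>. indicator A \<omega> \<partial>M)"
  proof (rule integral_cong_AE)
    have "AE \<omega> in M. real_cond_exp M F ?I \<omega> = measure_pmf.prob (K \<omega>) B"
      using law by (simp add: cond_law_def)
    with supp show "AE \<omega> in M. indicator A \<omega> * real_cond_exp M F ?I \<omega> = indicator A \<omega>"
    proof eventually_elim
      case (elim \<omega>)
      then have "\<omega> \<in> A \<Longrightarrow> measure_pmf.prob (K \<omega>) B = 1"
        by (subst measure_pmf.prob_eq_1) (auto intro: AE_pmfI)
      with elim show ?case by (auto simp: indicator_def)
    qed
  qed measurable
  finally have "(\<integral>\<omega>. indicator A \<omega> - indicator A \<omega> * ?I \<omega> \<partial>M) = 0"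
    using intA by simp
  moreover have "integrable M (\<lambda>\<omega>. indicator A \<omega> - indicator A \<omega> * ?I \<omega>)"
    by (intro Bochner_Integration.integrable_diff intA)
  moreover have "AE \<omega> in M. 0 \<le> indicator A \<omega> - indicator A \<omega> * ?I \<omega>"
    by (intro AE_I2) (simp split: split_indicator)
  ultimately have "AE \<omega> in M. indicator A \<omega> - indicator A \<omega> * ?I \<omega> = 0"
    using integral_nonneg_eq_0_iff_AE by blast
  then show ?thesis by eventually_elim (auto simp: indicator_def split: if_splits)
qed

text \<open>
  Integration against a conditional law, for laws carried by two \<open>F\<close>-measurable points with
  countably many values. Countability permits splitting \<open>\<Omega>\<close> into countably many events of
  \<open>F\<close> on which both points are constant, so that no measurability of \<open>K\<close> and no approximation
  of \<open>h\<close> is needed.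
\<close>

lemma real_cond_exp_two_point_kernel:
  fixes h :: "'a \<Rightarrow> real \<Rightarrow> real" and lo hi :: "'a \<Rightarrow> real"
  assumes M: "prob_space M" "subalgebra M F" and law: "cond_law M F X K"
    and X[measurable]: "X \<in> borel_measurable M"
    and lohi[measurable]: "lo \<in> borel_measurable F" "hi \<in> borel_measurable F"
    and C: "countable C" "\<And>\<omega>. lo \<omega> \<in> C" "\<And>\<omega>. hi \<omega> \<in> C"
    and supp: "AE \<omega> in M. set_pmf (K \<omega>) \<subseteq> {lo \<omega>, hi \<omega>}"
    and h[measurable]: "\<And>v. (\<lambda>\<omega>. h \<omega> v) \<in> borel_measurable F"
    and hX[measurable]: "(\<lambda>\<omega>. h \<omega> (X \<omega>)) \<in> borel_measurable M"
    and bound: "\<And>\<omega> v. v \<in> {lo \<omega>, hi \<omega>} \<Longrightarrow> \<bar>h \<omega> v\<bar> \<le> c"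
  shows "integrable M (\<lambda>\<omega>. h \<omega> (X \<omega>))"
    and "AE \<omega> in M. real_cond_exp M F (\<lambda>\<omega>. h \<omega> (X \<omega>)) \<omega> = measure_pmf.expectation (K \<omega>) (h \<omega>)"
proof -
  interpret finite_measure_subalgebra M F
    by (rule finite_measure_subalgebraI[OF M])
  interpret prob_space M by fact
  have spF: "space F = space M" using subalg by (simp add: subalgebra_def)
  have toM: "A \<in> sets F \<Longrightarrow> A \<in> sets M" for A using subalg by (auto simp: subalgebra_def)
  have hM[measurable]: "(\<lambda>\<omega>. h \<omega> v) \<in> borel_measurable M" for v
    by (rule measurable_from_subalg[OF subalg h])
  define D where "D y z = {\<omega> \<in> space F. lo \<omega> = y \<and> hi \<omega> = z}" for y z
  have DF[measurable]: "D y z \<in> sets F" for y z unfolding D_def by measurable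
  have DM[measurable]: "D y z \<in> sets M" for y z by (rule toM[OF DF])
  \<comment> \<open>The pieces \<open>D y z\<close> with \<open>y, z \<in> C\<close> cover the space, and there are countably many.\<close>
  have cover: "(AE \<omega> in M. P \<omega>) \<longleftrightarrow> (\<forall>y\<in>C. \<forall>z\<in>C. AE \<omega> in M. \<omega> \<in> D y z \<longrightarrow> P \<omega>)" for P
  proof -
    have "(AE \<omega> in M. P \<omega>) \<longleftrightarrow> (AE \<omega> in M. \<forall>y\<in>C. \<forall>z\<in>C. \<omega> \<in> D y z \<longrightarrow> P \<omega>)"
      by (rule AE_cong) (use C in \<open>auto simp: D_def spF\<close>)
    also have "\<dots> \<longleftrightarrow> (\<forall>y\<in>C. \<forall>z\<in>C. AE \<omega> in M. \<omega> \<in> D y z \<longrightarrow> P \<omega>)"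
      using C(1) by (simp only: AE_ball_countable)
    finally show ?thesis .
  qed
  have X_in: "AE \<omega> in M. \<omega> \<in> D y z \<longrightarrow> X \<omega> \<in> {y, z}" for y z
    by (rule cond_law_AE_in[OF M law X _ DF]) (use supp in \<open>auto simp: D_def\<close>)
  have "AE \<omega> in M. X \<omega> \<in> {lo \<omega>, hi \<omega>}"
  proof (rule cover[THEN iffD2], intro ballI)
    fix y z
    show "AE \<omega> in M. \<omega> \<in> D y z \<longrightarrow> X \<omega> \<in> {lo \<omega>, hi \<omega>}"
      using X_in[of y z] by eventually_elim (simp add: D_def)
  qed
  then have hX_bound: "AE \<omega> in M. \<bar>h \<omega> (X \<omega>)\<bar> \<le> c"
    by eventually_elim (rule bound)
  then show int: "integrable M (\<lambda>\<omega>. h \<omega> (X \<omega>))"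
    by (intro integrable_const_bound[of _ c]) auto
  show "AE \<omega> in M. real_cond_exp M F (\<lambda>\<omega>. h \<omega> (X \<omega>)) \<omega> = measure_pmf.expectation (K \<omega>) (h \<omega>)"
  proof (rule cover[THEN iffD2], intro ballI)
    fix y z
    \<comment> \<open>On \<open>D y z\<close> the value \<open>h \<omega> (X \<omega>)\<close> is almost surely a sum of at most two products of an
      \<open>F\<close>-measurable factor with the indicator of an event \<open>{X = v}\<close>. The factor
      \<open>indicator {y, z} v\<close> makes these products integrable for every \<open>v\<close>, since \<open>h\<close> is
      bounded only at \<open>lo\<close> and \<open>hi\<close>.\<close>
    define w where "w v \<omega> = indicator (D y z) \<omega> * indicator {y, z} v * h \<omega> v" for v \<omega>
    define I where "I v \<omega> = (indicator {v} (X \<omega>) :: real)" for v \<omega>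
    have wF[measurable]: "w v \<in> borel_measurable F" for v unfolding w_def by measurable
    have wM[measurable]: "w v \<in> borel_measurable M" for v
      by (rule measurable_from_subalg[OF subalg wF])
    have IM[measurable]: "I v \<in> borel_measurable M" for v unfolding I_def by measurable
    have c0: "0 \<le> c" using bound[of "lo undefined" undefined] by auto
    have intw: "integrable M (\<lambda>\<omega>. w v \<omega> * I v \<omega>)" for v
    proof (rule integrable_const_bound[of _ c])
      show "AE \<omega> in M. norm (w v \<omega> * I v \<omega>) \<le> c"
        using c0 bound by (auto simp: w_def I_def D_def indicator_def)
    qed measurable
    have intD: "integrable M (\<lambda>\<omega>. indicator (D y z) \<omega> * h \<omega> (X \<omega>))"
      using integrable_mult_indicator[OF DM int] by simp
    have "AE \<omega> in M. indicator (D y z) \<omega> * h \<omega> (X \<omega>) = (\<Sum>v\<in>{y, z}. w v \<omega> * I v \<omega>)"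
      using X_in[of y z] by eventually_elim (auto simp: w_def I_def indicator_def)
    then have "AE \<omega> in M. real_cond_exp M F (\<lambda>\<omega>. indicator (D y z) \<omega> * h \<omega> (X \<omega>)) \<omega>
        = real_cond_exp M F (\<lambda>\<omega>. \<Sum>v\<in>{y, z}. w v \<omega> * I v \<omega>) \<omega>"
      by (rule real_cond_exp_cong) measurable
    moreover have "AE \<omega> in M. real_cond_exp M F (\<lambda>\<omega>. \<Sum>v\<in>{y, z}. w v \<omega> * I v \<omega>) \<omega>
        = (\<Sum>v\<in>{y, z}. real_cond_exp M F (\<lambda>\<omega>. w v \<omega> * I v \<omega>) \<omega>)"
      by (rule real_cond_exp_sum) (rule intw)
    moreover have "AE \<omega> in M. \<forall>v\<in>{y, z}. real_cond_exp M F (\<lambda>\<omega>. w v \<omega> * I v \<omega>) \<omega>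
        = w v \<omega> * real_cond_exp M F (I v) \<omega>"
      by (subst AE_ball_countable) (auto intro!: real_cond_exp_mult intw)
    moreover have "AE \<omega> in M. \<forall>v\<in>{y, z}. real_cond_exp M F (I v) \<omega> = pmf (K \<omega>) v"
    proof (subst AE_ball_countable, simp, intro ballI)
      fix v
      show "AE \<omega> in M. real_cond_exp M F (I v) \<omega> = pmf (K \<omega>) v"
        using law[unfolded cond_law_def, rule_format, of "{v}"]
        by (simp add: I_def[abs_def] measure_pmf_single)
    qed
    moreover have "AE \<omega> in M. real_cond_exp M F (\<lambda>\<omega>. indicator (D y z) \<omega> * h \<omega> (X \<omega>)) \<omega>
        = indicator (D y z) \<omega> * real_cond_exp M F (\<lambda>\<omega>. h \<omega> (X \<omega>)) \<omega>"
      by (rule real_cond_exp_mult) (auto intro: intD)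
    ultimately show "AE \<omega> in M. \<omega> \<in> D y z \<longrightarrow>
        real_cond_exp M F (\<lambda>\<omega>. h \<omega> (X \<omega>)) \<omega> = measure_pmf.expectation (K \<omega>) (h \<omega>)"
      using supp
    proof eventually_elim
      case (elim \<omega>)
      show ?case
      proof
        assume \<omega>: "\<omega> \<in> D y z"
        have "real_cond_exp M F (\<lambda>\<omega>. h \<omega> (X \<omega>)) \<omega> = (\<Sum>v\<in>{y, z}. w v \<omega> * pmf (K \<omega>) v)"
          using elim(1-5) \<omega> by simp
        also have "\<dots> = (\<Sum>v\<in>{y, z}. h \<omega> v * pmf (K \<omega>) v)"
          by (rule sum.cong) (use \<omega> in \<open>auto simp: w_def\<close>)
        also have "\<dots> = measure_pmf.expectation (K \<omega>) (h \<omega>)"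
          using elim(6) \<omega> by (subst integral_measure_pmf_real[of "{y, z}"]) (auto simp: D_def)
        finally show "real_cond_exp M F (\<lambda>\<omega>. h \<omega> (X \<omega>)) \<omega> = measure_pmf.expectation (K \<omega>) (h \<omega>)" .
      qed
    qed
  qed
qed

section \<open>Measurability of the arithmetic\<close>

lemma borel_measurable_apply_op [measurable]:
  assumes [measurable]: "u \<in> borel_measurable N" "v \<in> borel_measurable N"
  shows "(\<lambda>\<omega>. apply_op q (u \<omega>) (v \<omega>)) \<in> borel_measurable N"
  by (cases q) simp_all

lemma borel_measurable_rel_err [measurable]:
  assumes [measurable]: "u \<in> borel_measurable N" "v \<in> borel_measurable N"
  shows "(\<lambda>\<omega>. rel_err (u \<omega>) (v \<omega>)) \<in> borel_measurable N"
  unfolding rel_err_def by measurable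

section \<open>Histories of a process\<close>

lemma measurable_past:
  assumes "\<And>j. j \<in> {1..<i} \<Longrightarrow> X j \<in> borel_measurable N"
  shows "past X i \<in> N \<rightarrow>\<^sub>M past_space i"
  unfolding past_def[abs_def] using assms by (intro measurable_restrict) auto

lemma past_sigma_component_measurable:
  assumes "j \<in> {1..<i}"
  shows "X j \<in> borel_measurable (past_sigma M X i)"
proof -
  have "past X i \<in> past_sigma M X i \<rightarrow>\<^sub>M past_space i"
    unfolding past_sigma_def by (rule measurable_vimage_algebra1) (auto simp: past_def space_PiM)
  then have "(\<lambda>\<omega>. past X i \<omega> j) \<in> borel_measurable (past_sigma M X i)"
    by (rule measurable_compose) (rule measurable_component_singleton[OF assms])
  then show ?thesis using assms by (simp add: past_def cong: measurable_cong)
qed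

text \<open>Minimality of the sigma-algebra generated by a history.\<close>

lemma sets_past_sigma_subset:
  assumes "past X i \<in> N \<rightarrow>\<^sub>M past_space i" "space N = space M"
  shows "sets (past_sigma M X i) \<subseteq> sets N"
proof -
  have "past X i \<in> space N \<rightarrow> space (past_space i)"
    using assms(1) by (rule measurable_space[THEN funcsetI])
  then show ?thesis
    unfolding past_sigma_def assms(2)[symmetric]
    using assms(1) by (auto simp: sets_vimage_algebra2 simp del: One_nat_def intro: measurable_sets)
qed

lemma subalgebra_past_sigma:
  assumes "\<And>j. j \<in> {1..<i} \<Longrightarrow> X j \<in> borel_measurable M"
  shows "subalgebra M (past_sigma M X i)"
  unfolding subalgebra_def
  using sets_past_sigma_subset[OF measurable_past[OF assms]] by (simp add: past_sigma_def)

lemma past_sigma_measurable_mono: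
  assumes "j \<le> i" "u \<in> borel_measurable (past_sigma M X j)"
  shows "u \<in> borel_measurable (past_sigma M X i)"
proof -
  have "past X j \<in> past_sigma M X i \<rightarrow>\<^sub>M past_space j"
    using assms(1) by (intro measurable_past past_sigma_component_measurable) auto
  from sets_past_sigma_subset[OF this, of M]
  have "subalgebra (past_sigma M X i) (past_sigma M X j)"
    by (simp add: subalgebra_def past_sigma_def)
  then show ?thesis by (rule measurable_from_subalg) (rule assms(2))
qed

section \<open>The conditional mean of a rounding error\<close>

theorem lemma3:
  fixes M :: "'a measure"
    and p r k :: nat
    and opr :: "nat \<Rightarrow> arith_op"
    and f g :: "nat \<Rightarrow> (nat \<Rightarrow> real) \<Rightarrow> real"
    and a b c chat \<delta> :: "nat \<Rightarrow> 'a \<Rightarrow> real"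
    and \<beta> :: "'a \<Rightarrow> real"
  assumes "prob_space M"
    and "p \<ge> 1" and "r \<ge> 1" and "k \<ge> 1"
    and chat_rv: "\<And>i. i \<in> {1..k} \<Longrightarrow> chat i \<in> borel_measurable M"
    and f_meas: "\<And>i. i \<in> {1..k} \<Longrightarrow> f i \<in> borel_measurable (past_space i)"
    and g_meas: "\<And>i. i \<in> {1..k} \<Longrightarrow> g i \<in> borel_measurable (past_space i)"
    and a_def: "\<And>i \<omega>. i \<in> {1..k} \<Longrightarrow> a i \<omega> = f i (past chat i \<omega>)"
    and b_def: "\<And>i \<omega>. i \<in> {1..k} \<Longrightarrow> b i \<omega> = g i (past chat i \<omega>)"
    and div_ok: "\<And>i. i \<in> {1..k} \<Longrightarrow> opr i = Div \<Longrightarrow> AE \<omega> in M. b i \<omega> \<noteq> 0"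
    and c_def: "\<And>i \<omega>. i \<in> {1..k} \<Longrightarrow> c i \<omega> = apply_op (opr i) (a i \<omega>) (b i \<omega>)"
    and \<delta>_def: "\<And>i \<omega>. i \<in> {1..k} \<Longrightarrow> \<delta> i \<omega> = rel_err (c i \<omega>) (chat i \<omega>)"
    and SR_step: "\<And>i. i \<in> {1..k} \<Longrightarrow>
      cond_law M (past_sigma M \<delta> i) (chat i) (\<lambda>\<omega>. SR p r (c i \<omega>))"
    and \<beta>_def: "\<And>\<omega>. \<beta> \<omega> = rel_err (c k \<omega>) (fp_trunc (p + r) (c k \<omega>))"
  shows "integrable M (\<delta> k) \<and>
    (AE \<omega> in M. real_cond_exp M (past_sigma M \<delta> k) (\<delta> k) \<omega> = \<beta> \<omega>)"
proof -
  interpret prob_space M by fact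
  let ?F = "past_sigma M \<delta>"
  have k: "k \<in> {1..k}" using \<open>k \<ge> 1\<close> by simp
  have c_fun: "c i = (\<lambda>\<omega>. apply_op (opr i) (f i (past chat i \<omega>)) (g i (past chat i \<omega>)))"
    if "i \<in> {1..k}" for i
    by (rule ext) (simp only: c_def[OF that] a_def[OF that] b_def[OF that])
  have c_meas: "c i \<in> borel_measurable N" if i: "i \<in> {1..k}" and "past chat i \<in> N \<rightarrow>\<^sub>M past_space i" for i N
    unfolding c_fun[OF i] using that
    by (intro borel_measurable_apply_op measurable_compose[OF _ f_meas] measurable_compose[OF _ g_meas])
  have c_rv: "c i \<in> borel_measurable M" if "i \<in> {1..k}" for i
    using that chat_rv by (intro c_meas measurable_past) auto
  have \<delta>_rv: "\<delta> i \<in> borel_measurable M" if i: "i \<in> {1..k}" for i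
  proof -
    note [measurable] = c_rv[OF i] chat_rv[OF i]
    have "\<delta> i = (\<lambda>\<omega>. rel_err (c i \<omega>) (chat i \<omega>))" using \<delta>_def[OF i] by (rule ext)
    then show ?thesis by simp
  qed
  have sub: "subalgebra M (?F i)" if "i \<in> {1..k}" for i
    using that \<delta>_rv by (intro subalgebra_past_sigma) auto

  \<comment> \<open>The computed value is recovered from the exact one and the error. Where \<open>c i\<close> vanishes,
    \<open>\<delta> i = 0\<close> holds by convention and carries no information about \<open>chat i\<close>; there the
    conditional law of \<open>chat i\<close>, a point mass at \<open>0\<close>, is what forces \<open>chat i = 0\<close>.\<close>
  have chat_eq: "AE \<omega> in M. chat i \<omega> = c' \<omega> * (1 + \<delta> i \<omega>)"
    if i: "i \<in> {1..k}" and [measurable]: "c' \<in> borel_measurable (?F i)"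
      and c': "AE \<omega> in M. c i \<omega> = c' \<omega>" for i c'
  proof -
    have "AE \<omega> in M. \<omega> \<in> {\<omega> \<in> space (?F i). c' \<omega> = 0} \<longrightarrow> chat i \<omega> \<in> {0}"
    proof (rule cond_law_AE_in[OF \<open>prob_space M\<close> sub[OF i] SR_step[OF i] chat_rv[OF i]])
      show "AE \<omega> in M. \<omega> \<in> {\<omega> \<in> space (?F i). c' \<omega> = 0} \<longrightarrow> set_pmf (SR p r (c i \<omega>)) \<subseteq> {0}"
        using c' by eventually_elim (simp add: SR_def)
    qed measurable
    with c' AE_space show ?thesis
    proof eventually_elim
      case (elim \<omega>)
      show ?case
      proof (cases "c' \<omega> = 0")
        case True
        then show ?thesis using elim by (simp add: past_sigma_def)
      next
        case False
        then show ?thesis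
          using elim(1) by (subst rel_err_iff) (auto simp: \<delta>_def[OF i])
      qed
    qed
  qed

  \<comment> \<open>\<open>c i\<close> is a function of earlier computed values, whereas the conditioning is on earlier
    errors. Replacing each earlier computed value by \<open>c' j * (1 + \<delta> j)\<close> shows by induction
    that \<open>c i\<close> is almost surely a function of the earlier errors.\<close>
  have c_version: "\<exists>c'. c' \<in> borel_measurable (?F i) \<and> (AE \<omega> in M. c i \<omega> = c' \<omega>)"
    if "i \<in> {1..k}" for i
    using that
  proof (induction i rule: less_induct)
    case (less i)
    have "\<forall>j\<in>{1..<i}. \<exists>c'. c' \<in> borel_measurable (?F j) \<and> (AE \<omega> in M. c j \<omega> = c' \<omega>)"
      using less by simp
    then obtain c' where c': "\<And>j. j \<in> {1..<i} \<Longrightarrow> c' j \<in> borel_measurable (?F j)"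
      "\<And>j. j \<in> {1..<i} \<Longrightarrow> AE \<omega> in M. c j \<omega> = c' j \<omega>"
      by metis
    define chat' where "chat' j \<omega> = c' j \<omega> * (1 + \<delta> j \<omega>)" for j \<omega>
    have "AE \<omega> in M. \<forall>j\<in>{1..<i}. chat j \<omega> = chat' j \<omega>"
      unfolding chat'_def using less.prems c'
      by (subst AE_ball_countable) (auto intro!: chat_eq)
    then have "AE \<omega> in M. past chat i \<omega> = past chat' i \<omega>"
      by eventually_elim (auto simp: past_def intro!: restrict_ext)
    then have "AE \<omega> in M. c i \<omega>
        = apply_op (opr i) (f i (past chat' i \<omega>)) (g i (past chat' i \<omega>))"
      by eventually_elim (simp add: c_fun[OF less.prems])
    moreover have "past chat' i \<in> ?F i \<rightarrow>\<^sub>M past_space i"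
    proof (rule measurable_past)
      fix j assume j: "j \<in> {1..<i}"
      have [measurable]: "c' j \<in> borel_measurable (?F i)"
        using j by (intro past_sigma_measurable_mono[OF _ c'(1)]) auto
      have [measurable]: "\<delta> j \<in> borel_measurable (?F i)"
        by (rule past_sigma_component_measurable[OF j])
      show "chat' j \<in> borel_measurable (?F i)"
        unfolding chat'_def by measurable
    qed
    then have "(\<lambda>\<omega>. apply_op (opr i) (f i (past chat' i \<omega>)) (g i (past chat' i \<omega>)))
        \<in> borel_measurable (?F i)"
      using less.prems
      by (intro borel_measurable_apply_op measurable_compose[OF _ f_meas] measurable_compose[OF _ g_meas])
    ultimately show ?case by blast
  qed

  obtain c' where c'_meas[measurable]: "c' \<in> borel_measurable (?F k)"
    and c': "AE \<omega> in M. c k \<omega> = c' \<omega>"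
    using c_version[OF k] by blast
  note [measurable] = borel_measurable_fp_floor[OF \<open>p \<ge> 1\<close>] borel_measurable_fp_ceil[OF \<open>p \<ge> 1\<close>]
    chat_rv[OF k] \<delta>_rv[OF k] measurable_from_subalg[OF sub[OF k] c'_meas]
  have "AE \<omega> in M. set_pmf (SR p r (c k \<omega>)) \<subseteq> {fp_floor p (c' \<omega>), fp_ceil p (c' \<omega>)}"
    using c' by eventually_elim (use set_pmf_SR[OF \<open>p \<ge> 1\<close>] in simp)
  note kernel = real_cond_exp_two_point_kernel[OF \<open>prob_space M\<close> sub[OF k] SR_step[OF k] chat_rv[OF k]
      _ _ countable_fp_set fp_floor_props(1)[OF \<open>p \<ge> 1\<close>] fp_ceil_in_fp_set[OF \<open>p \<ge> 1\<close>] this,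
      where h = "\<lambda>\<omega>. rel_err (c' \<omega>)" and c = 1, OF _ _ _ _ abs_rel_err_le_1[OF \<open>p \<ge> 1\<close>]]
  have \<delta>_eq: "AE \<omega> in M. \<delta> k \<omega> = rel_err (c' \<omega>) (chat k \<omega>)"
    using c' by eventually_elim (simp add: \<delta>_def[OF k])
  have "integrable M (\<lambda>\<omega>. rel_err (c' \<omega>) (chat k \<omega>))"
    by (rule kernel(1)) measurable
  then have "integrable M (\<delta> k)"
    by (subst integrable_cong_AE[OF _ _ \<delta>_eq]) measurable
  interpret F: finite_measure_subalgebra M "?F k"
    by (rule finite_measure_subalgebraI[OF \<open>prob_space M\<close> sub[OF k]])
  have "AE \<omega> in M. real_cond_exp M (?F k) (\<delta> k) \<omega>
      = real_cond_exp M (?F k) (\<lambda>\<omega>. rel_err (c' \<omega>) (chat k \<omega>)) \<omega>"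
    by (rule F.real_cond_exp_cong[OF \<delta>_eq]) measurable
  moreover have "AE \<omega> in M. real_cond_exp M (?F k) (\<lambda>\<omega>. rel_err (c' \<omega>) (chat k \<omega>)) \<omega>
      = measure_pmf.expectation (SR p r (c k \<omega>)) (rel_err (c' \<omega>))"
    by (rule kernel(2)) measurable
  ultimately have "AE \<omega> in M. real_cond_exp M (?F k) (\<delta> k) \<omega> = \<beta> \<omega>"
    using c' by eventually_elim (simp add: \<beta>_def expectation_rel_err_SR[OF \<open>p \<ge> 1\<close>])
  with \<open>integrable M (\<delta> k)\<close> show ?thesis by blast
qed

end
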